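(* Let $n,m\ge0$ be integers. The dot product of the dual third order Jacobsthal vectors $\overrightarrow{JD_{n}^{(3)}}$ and $\overrightarrow{JD_{m}^{(3)}}$ is $$\left\langle \overrightarrow{JD_{n}^{(3)}},\overrightarrow{JD_{m}^{(3)}} \right\rangle=\frac{1}{7}\Big(3\cdot2^{n+m+2}(1+4\varepsilon)-2^{n+1}(UD_{m}+2\varepsilon U_{m})-2^{m+1}(UD_{n}+2\varepsilon U_{n})+W_{n-m}(1-\varepsilon)\Big),$$ where $U_{k}=H_{k}(0,1)$, $W_{k}=H_{k}(2,-1)$ and $UD_{k}=U_{k}+\varepsilon U_{k+1}$ for integers $k$.
   Context: Dual numbers are $a+\varepsilon b$ with $a,b\in\mathbb{R}$, $\varepsilon\ne0$, $\varepsilon^2=0$. The third order Jacobsthal numbers are defined by $J_0^{(3)}=0$, $J_1^{(3)}=J_2^{(3)}=1$, $J_{n+3}^{(3)}=J_{n+2}^{(3)}+J_{n+1}^{(3)}+2J_n^{(3)}$ for $n\ge0$. For $n\ge0$ let $\overrightarrow{J_n^{(3)}}=(J_n^{(3)},J_{n+1}^{(3)},J_{n+2}^{(3)})\in\mathbb{R}^3$, and define the dual third order Jacobsthal vector $\overrightarrow{JD_n^{(3)}}=\overrightarrow{J_n^{(3)}}+\varepsilon\overrightarrow{J_{n+1}^{(3)}}$. The dot product of dual vectors $\overrightarrow{d_i}=\overrightarrow{a_i}+\varepsilon\overrightarrow{b_i}$ ($\overrightarrow{a_i},\overrightarrow{b_i}\in\mathbb{R}^3$, $i=1,2$) is the dual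 number $\langle\overrightarrow{d_1},\overrightarrow{d_2}\rangle=\langle\overrightarrow{a_1},\overrightarrow{a_2}\rangle+\varepsilon(\langle\overrightarrow{a_1},\overrightarrow{b_2}\rangle+\langle\overrightarrow{b_1},\overrightarrow{a_2}\rangle)$, with the standard inner product on $\mathbb{R}^3$ on the right. For real $a,b$ and an integer $n$ (possibly negative), $H_n(a,b)=a$ if $n\equiv0\pmod 3$, $H_n(a,b)=b$ if $n\equiv1\pmod 3$, $H_n(a,b)=-(a+b)$ if $n\equiv2\pmod 3$. *)

theory Defs
  imports "HOL-Analysis.Analysis"
begin

text \<open>
  \<open>Dual a b\<close> is $a + \varepsilon b$. The type is polymorphic so that it covers both the dual numbers
  (\<open>real dual\<close>) and the dual vectors of the three-dimensional real space (\<open>(real ^ 3) dual\<close>).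
\<close>

datatype 'a dual = Dual (real_part: 'a) (dual_part: 'a)

instantiation dual :: (ab_group_add) ab_group_add
begin
definition "0 = Dual 0 0"
definition "x + y = Dual (real_part x + real_part y) (dual_part x + dual_part y)"
definition "- x = Dual (- real_part x) (- dual_part x)"
definition "x - y = Dual (real_part x - real_part y) (dual_part x - dual_part y)"
instance
  by standard
    (simp_all add: zero_dual_def plus_dual_def uminus_dual_def minus_dual_def algebra_simps)
end

instantiation dual :: (comm_ring_1) comm_ring_1
begin
definition "1 = Dual 1 0"
definition "x * y =
  Dual (real_part x * real_part y) (real_part x * dual_part y + dual_part x * real_part y)"
instance
  by standard
    (simp_all add: zero_dual_def plus_dual_def one_dual_def times_dual_def algebra_simps)
end

instantiation dual :: (real_vector) real_vector
begin
definition "scaleR r x = Dual (r *\<^sub>R real_part x) (r *\<^sub>R dual_part x)"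
instance
  by standard (simp_all add: plus_dual_def scaleR_dual_def algebra_simps)
end

instance dual :: ("{comm_ring_1, real_algebra_1}") real_algebra_1
  by standard (simp_all add: times_dual_def scaleR_dual_def algebra_simps)

definition eps :: "real dual" where
  "eps = Dual 0 1"

lemma eps_nonzero: "eps \<noteq> 0"
  by (simp add: eps_def zero_dual_def)

lemma eps_squared: "eps ^ 2 = 0"
  by (simp add: eps_def zero_dual_def times_dual_def power2_eq_square)

lemma Dual_eq: "Dual a b = of_real a + eps * of_real b"
  by (simp add: eps_def of_real_def plus_dual_def times_dual_def one_dual_def scaleR_dual_def)

fun jacobsthal3 :: "nat \<Rightarrow> nat" where
  "jacobsthal3 0 = 0"
| "jacobsthal3 (Suc 0) = 1"
| "jacobsthal3 (Suc (Suc 0)) = 1"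
| "jacobsthal3 (Suc (Suc (Suc n))) =
     jacobsthal3 (Suc (Suc n)) + jacobsthal3 (Suc n) + 2 * jacobsthal3 n"

definition jacobsthal3_vec :: "nat \<Rightarrow> real ^ 3" where
  "jacobsthal3_vec n =
     vector [real (jacobsthal3 n), real (jacobsthal3 (n + 1)), real (jacobsthal3 (n + 2))]"

definition dual_jacobsthal3_vec :: "nat \<Rightarrow> (real ^ 3) dual" where
  "dual_jacobsthal3_vec n = Dual (jacobsthal3_vec n) (jacobsthal3_vec (n + 1))"

definition dual_dot :: "(real ^ 3) dual \<Rightarrow> (real ^ 3) dual \<Rightarrow> real dual" where
  "dual_dot x y =
     Dual (real_part x \<bullet> real_part y) (real_part x \<bullet> dual_part y + dual_part x \<bullet> real_part y)"

text \<open>On \<open>int\<close>, \<open>mod 3\<close> takes values in $\{0, 1, 2\}$ for negative arguments as well.\<close>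

definition H :: "real \<Rightarrow> real \<Rightarrow> int \<Rightarrow> real" where
  "H a b n = (if n mod 3 = 0 then a else if n mod 3 = 1 then b else - (a + b))"

definition U :: "int \<Rightarrow> real" where
  "U k = H 0 1 k"

definition W :: "int \<Rightarrow> real" where
  "W k = H 2 (-1) k"

definition UD :: "int \<Rightarrow> real dual" where
  "UD k = of_real (U k) + eps * of_real (U (k + 1))"

end

theory Submission
  imports Defs
begin

text \<open>
  The characteristic polynomial of the recurrence is $x^3 - x^2 - x - 2 = (x - 2)(x^2 + x + 1)$, so
  a third order Jacobsthal number is a combination of a power of 2 and of a sequence of period 3
  that sums to zero over a period. Matching initial values gives the Binet formula
  $7 J_n = 2^{n+1} - V_n$ with $V_n = H_n(2, -3)$.

  Inserting it into $J_n J_m + J_{n+1} J_{m+1} + J_{n+2} J_{m+2}$ produces three kinds of sums: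
  $4 (1 + 4 + 16)\, 2^{n+m}$ from the powers of 2, the mixed sums
  $V_k + 2 V_{k+1} + 4 V_{k+2} = 7 U_k$, and the sum of the products $V_{n+i} V_{m+i}$ over one full
  period, which depends only on $n - m$ and equals $7 W_{n-m}$. In each of them one factor 7 of the
  denominator 49 cancels; this is the real part. The dual part is the sum of two such real dot
  products, of indices $(n, m + 1)$ and $(n + 1, m)$, and there the periodic terms combine by
  $W_{k-1} + W_{k+1} = - W_k$.
\<close>

text \<open>
  Every identity between values of \<open>H\<close> at shifted arguments is settled by inspecting the residues
  modulo 3: case distinction leaves only arithmetic once the residue of the shifted argument is
  expressed by that of \<open>k\<close>.
\<close>

lemma int_mod_3_cases:
  fixes k :: int
  obtains "k mod 3 = 0" | "k mod 3 = 1" | "k mod 3 = 2"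
  by linarith

lemma H_Suc_residue:
  "H a b (k + 1) = (if k mod 3 = 0 then b else if k mod 3 = 1 then - (a + b) else a)"
proof -
  have "(k + 1) mod 3 = (if k mod 3 = 2 then 0 else k mod 3 + 1)"
    by presburger
  then show ?thesis
    by (cases rule: int_mod_3_cases[of k]) (simp_all add: H_def)
qed

text \<open>The factor $x^2 + x + 1$ of the characteristic polynomial annihilates \<open>H a b\<close>.\<close>

lemma H_recurrence: "H a b (k + 2) = - H a b (k + 1) - H a b k"
proof -
  have "H a b (k + 2) = H a b ((k + 1) + 1)"
    by (simp add: add.assoc)
  moreover have "(k + 1) mod 3 = (if k mod 3 = 2 then 0 else k mod 3 + 1)"
    by presburger
  ultimately show ?thesis
    unfolding H_Suc_residue
    by (cases rule: int_mod_3_cases[of k]) (simp_all add: H_def)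
qed

lemma jacobsthal3_binet: "7 * real (jacobsthal3 n) = 2 ^ (n + 1) - H 2 (-3) (int n)"
proof (induction n rule: jacobsthal3.induct)
  case (4 n)
  have "H 2 (-3) (int n + 3) = H 2 (-3) (int n)"
    by (simp add: H_def)
  moreover have "H 2 (-3) (int n + 2) = - H 2 (-3) (int n + 1) - H 2 (-3) (int n)"
    by (rule H_recurrence)
  ultimately show ?case
    using 4 by (simp add: algebra_simps)
qed (simp_all add: H_def)

lemma H_weighted_sum:
  "H 2 (-3) k + 2 * H 2 (-3) (k + 1) + 4 * H 2 (-3) (k + 2) = 7 * U k"
  unfolding H_recurrence H_Suc_residue U_def
  by (cases rule: int_mod_3_cases[of k]) (simp_all add: H_def)

text \<open>
  Shifting both arguments by one permutes the summands cyclically, which is why the left side is a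
  function of \<open>k - l\<close>.
\<close>

lemma H_period_correlation:
  "H 2 (-3) k * H 2 (-3) l + H 2 (-3) (k + 1) * H 2 (-3) (l + 1)
     + H 2 (-3) (k + 2) * H 2 (-3) (l + 2) = 7 * W (k - l)"
proof -
  have "(k - l) mod 3 = (k mod 3 - l mod 3) mod 3"
    by (simp add: mod_diff_eq)
  then show ?thesis
    unfolding H_recurrence H_Suc_residue W_def
    by (cases rule: int_mod_3_cases[of k]; cases rule: int_mod_3_cases[of l])
      (simp_all add: H_def)
qed

lemma W_neighbours: "W (k - 1) + W (k + 1) = - W k"
  using H_recurrence[of 2 "-1" "k - 1"] by (simp add: W_def add.commute)

lemma jacobsthal3_vec_dot:
  "jacobsthal3_vec n \<bullet> jacobsthal3_vec m =
     (12 * 2 ^ (n + m) - 2 ^ (n + 1) * U (int m) - 2 ^ (m + 1) * U (int n)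
      + W (int n - int m)) / 7"
proof -
  define v where "v = (\<lambda>k. H 2 (-3) (int k))"
  have J: "real (jacobsthal3 k) = (2 * 2 ^ k - v k) / 7" for k
    using jacobsthal3_binet[of k] by (simp add: v_def)
  have weighted: "v k + 2 * v (k + 1) + 4 * v (k + 2) = 7 * U (int k)" for k
    using H_weighted_sum[of "int k"] by (simp add: v_def algebra_simps)
  have correlation:
    "v n * v m + v (n + 1) * v (m + 1) + v (n + 2) * v (m + 2) = 7 * W (int n - int m)"
    using H_period_correlation[of "int n" "int m"] by (simp add: v_def algebra_simps)
  have "49 * (jacobsthal3_vec n \<bullet> jacobsthal3_vec m) =
      49 * (real (jacobsthal3 n) * real (jacobsthal3 m)
        + real (jacobsthal3 (n + 1)) * real (jacobsthal3 (m + 1))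
        + real (jacobsthal3 (n + 2)) * real (jacobsthal3 (m + 2)))"
    by (simp add: jacobsthal3_vec_def inner_vec_def sum_3 vector_3 del: jacobsthal3.simps)
  also have "\<dots> = 84 * 2 ^ (n + m)
      - 2 ^ (n + 1) * (v m + 2 * v (m + 1) + 4 * v (m + 2))
      - 2 ^ (m + 1) * (v n + 2 * v (n + 1) + 4 * v (n + 2))
      + (v n * v m + v (n + 1) * v (m + 1) + v (n + 2) * v (m + 2))"
    unfolding J by (simp add: power_add field_simps)
  finally show ?thesis
    unfolding weighted correlation by simp
qed

lemma of_real_dual: "of_real r = (Dual r 0 :: real dual)"
  by (simp add: of_real_def one_dual_def scaleR_dual_def)

lemma UD_eq_Dual: "UD k = Dual (U k) (U (k + 1))"
  unfolding UD_def by (rule Dual_eq[symmetric])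

theorem theorem3p2:
  fixes n m :: nat
  shows "dual_dot (dual_jacobsthal3_vec n) (dual_jacobsthal3_vec m) =
    (1 / 7) *\<^sub>R
      (3 * 2 ^ (n + m + 2) * (1 + 4 * eps)
       - 2 ^ (n + 1) * (UD (int m) + 2 * eps * of_real (U (int m)))
       - 2 ^ (m + 1) * (UD (int n) + 2 * eps * of_real (U (int n)))
       + of_real (W (int n - int m)) * (1 - eps))"
proof -
  \<comment> \<open>Writing every numeral as an embedded real number exposes the components of the products.\<close>
  have numerals: "3 * 2 ^ k = (Dual (3 * 2 ^ k) 0 :: real dual)"
      "2 ^ k = (Dual (2 ^ k) 0 :: real dual)"
      "4 = (Dual 4 0 :: real dual)" "2 = (Dual 2 0 :: real dual)" for k
    unfolding of_real_dual[symmetric] by simp_all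
  have W: "W (int n - int (m + 1)) + W (int (n + 1) - int m) = - W (int n - int m)"
    using W_neighbours[of "int n - int m"] by (simp add: algebra_simps)
  have "dual_dot (dual_jacobsthal3_vec n) (dual_jacobsthal3_vec m) =
      Dual (jacobsthal3_vec n \<bullet> jacobsthal3_vec m)
        (jacobsthal3_vec n \<bullet> jacobsthal3_vec (m + 1)
          + jacobsthal3_vec (n + 1) \<bullet> jacobsthal3_vec m)"
    by (simp add: dual_dot_def dual_jacobsthal3_vec_def)
  also have "\<dots> = Dual
      ((12 * 2 ^ (n + m) - 2 ^ (n + 1) * U (int m) - 2 ^ (m + 1) * U (int n)
        + W (int n - int m)) / 7)
      ((48 * 2 ^ (n + m) - 2 ^ (n + 1) * (U (int m + 1) + 2 * U (int m))
        - 2 ^ (m + 1) * (U (int n + 1) + 2 * U (int n)) - W (int n - int m)) / 7)"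
    unfolding jacobsthal3_vec_dot using W by (simp add: field_simps)
  also have "\<dots> = (1 / 7) *\<^sub>R
      (Dual (3 * 2 ^ (n + m + 2)) 0 * (1 + Dual 4 0 * eps)
       - Dual (2 ^ (n + 1)) 0 * (UD (int m) + Dual 2 0 * eps * of_real (U (int m)))
       - Dual (2 ^ (m + 1)) 0 * (UD (int n) + Dual 2 0 * eps * of_real (U (int n)))
       + of_real (W (int n - int m)) * (1 - eps))"
    by (simp add: of_real_dual UD_eq_Dual eps_def one_dual_def plus_dual_def minus_dual_def
        times_dual_def scaleR_dual_def power_add field_simps)
  finally show ?thesis
    unfolding numerals(1)[symmetric] numerals(2)[symmetric]
    unfolding numerals(3,4)[symmetric] .
qed

end
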